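(* Let $\mathcal{S}=\{S_m,m\in\mathcal{M}\}$ be a collection of models such that $N_m\ge2$ for all $m\in\mathcal{M}$. Let $\mathrm{pen}$ be an arbitrary penalty function mapping $\mathcal{M}$ into $\mathbb{R}_+$. Assume that there exists, with probability 1, an index $\hat m\in\mathcal{M}$ which minimizes over $m\in\mathcal{M}$ $$\mathrm{Crit}_L(m)=\|Y-\Pi_mY\|^2\left(1+\frac{\mathrm{pen}(m)}{N_m}\right).$$ Then, for all constants $c\ge0$ and $K>1$, the estimator $\hat\mu_{\hat m}$ satisfies $$\mathbb{E}\left[\frac{\|\mu-\hat\mu_{\hat m}\|^2}{\sigma^2}\right]\le\frac{K}{K-1}\inf_{m\in\mathcal{M}}\left[\frac{\|\mu-\mu_m\|^2}{\sigma^2}\left(1+\frac{\mathrm{pen}(m)}{N_m}\right)+\mathrm{pen}(m)-D_m\right]+\Sigma,$$ where $$\Sigma=\frac{Kc}{K-1}+\frac{2K^2}{K-1}\sum_{m\in\mathcal{M}}(D_m+1)\,\mathsf{Dkhi}\left[D_m+1,\,N_m-1,\,\frac{N_m-1}{KN_m}(\mathrm{pen}(m)+c)\right].$$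
   Context: Model: $Y=(Y_1,\dots,Y_n)'$ with $Y_i=\mu_i+\sigma\varepsilon_i$, $i=1,\dots,n$, where $\mu=(\mu_1,\dots,\mu_n)'\in\mathbb{R}^n$ and $\sigma>0$ are unknown and the $\varepsilon_i$ are i.i.d. standard Gaussian. $\|\cdot\|$ is the Euclidean norm on $\mathbb{R}^n$. $\mathcal{S}=\{S_m,m\in\mathcal{M}\}$ is a collection of linear subspaces (models) of $\mathbb{R}^n$ indexed by a finite or countable set $\mathcal{M}$; $\Pi_m$ is the orthogonal projector onto $S_m$, $D_m=\dim S_m$, $N_m=n-D_m$, $\mu_m=\Pi_m\mu$, $\hat\mu_m=\Pi_mY$. For positive integers $D,N$ and $x\ge0$, with $X_D,X_N$ independent $\chi^2$ random variables with $D$ and $N$ degrees of freedom respectively, $$\mathsf{Dkhi}[D,N,x]=\frac{1}{\mathbb{E}(X_D)}\,\mathbb{E}\left[\left(X_D-x\frac{X_N}{N}\right)_+\right],$$ where $(\cdot)_+$ denotes the positive part. *)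

theory Defs
  imports "HOL-Probability.Probability"
begin

definition orth_proj :: "'a::euclidean_space set \<Rightarrow> 'a \<Rightarrow> 'a" where
  "orth_proj S y = (THE p. p \<in> S \<and> (\<forall>v\<in>S. orthogonal (y - p) v))"

(* THE is well defined on subspaces. *)
lemma orth_proj_unique_exists:
  fixes S :: "'a::euclidean_space set"
  assumes "subspace S"
  shows "\<exists>!p. p \<in> S \<and> (\<forall>v\<in>S. orthogonal (y - p) v)"
proof (rule ex_ex1I)
  obtain p z where "p \<in> span S" "\<And>w. w \<in> span S \<Longrightarrow> orthogonal z w" "y = p + z"
    using orthogonal_subspace_decomp_exists[of S y] by metis
  then show "\<exists>p. p \<in> S \<and> (\<forall>v\<in>S. orthogonal (y - p) v)"
    using assms by (metis add_diff_cancel_left' span_eq_iff)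
next
  fix p q
  assume p: "p \<in> S \<and> (\<forall>v\<in>S. orthogonal (y - p) v)"
    and q: "q \<in> S \<and> (\<forall>v\<in>S. orthogonal (y - q) v)"
  then have "p - q \<in> S" using assms subspace_diff by blast
  with p q have "(y - q) \<bullet> (p - q) = 0" "(y - p) \<bullet> (p - q) = 0"
    by (auto simp: orthogonal_def)
  then have "(p - q) \<bullet> (p - q) = 0" by (simp add: inner_diff_left)
  then show "p = q" by simp
qed

definition codim :: "'a::euclidean_space set \<Rightarrow> nat" where
  "codim S = DIM('a) - dim S"

definition observation :: "real ^ 'n \<Rightarrow> real \<Rightarrow> ('n \<Rightarrow> 'w \<Rightarrow> real) \<Rightarrow> 'w \<Rightarrow> real ^ 'n" where
  "observation \<mu> \<sigma> \<epsilon> \<omega> = (\<chi> i. \<mu> $ i + \<sigma> * \<epsilon> i \<omega>)"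

definition crit_L ::
  "('m \<Rightarrow> (real ^ 'n) set) \<Rightarrow> ('m \<Rightarrow> real) \<Rightarrow> real ^ 'n \<Rightarrow> 'm \<Rightarrow> real" where
  "crit_L S pen y m = (norm (y - orth_proj (S m) y))\<^sup>2 * (1 + pen m / real (codim (S m)))"

(* Law of the sum of the squares of k independent standard Gaussian variables. *)
definition chi_squared :: "nat \<Rightarrow> real measure" where
  "chi_squared k =
     distr (PiM {..<k} (\<lambda>_. density lborel std_normal_density)) borel (\<lambda>z. \<Sum>i<k. (z i)\<^sup>2)"

(* The product measure is the joint law of the independent pair (X_D, X_N). *)
definition Dkhi :: "nat \<Rightarrow> nat \<Rightarrow> real \<Rightarrow> real" where
  "Dkhi D N x =
     1 / (\<integral>u. u \<partial>chi_squared D) *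
     (\<integral>(u, v). max 0 (u - x * (v / real N)) \<partial>(chi_squared D \<Otimes>\<^sub>M chi_squared N))"

(* Extended-real valued because the series over the models may diverge. *)
definition risk_remainder ::
  "'m set \<Rightarrow> ('m \<Rightarrow> (real ^ 'n) set) \<Rightarrow> ('m \<Rightarrow> real) \<Rightarrow> real \<Rightarrow> real \<Rightarrow> ereal" where
  "risk_remainder \<M> S pen K c =
     ereal (K * c / (K - 1)) +
     ereal (2 * K\<^sup>2 / (K - 1)) *
       (\<Sum>\<^sub>\<infinity>m\<in>\<M>. ereal (real (dim (S m) + 1) *
          Dkhi (dim (S m) + 1) (codim (S m) - 1)
            (real (codim (S m) - 1) / (K * real (codim (S m))) * (pen m + c))))"

end

theory Submission
  imports Defs
begin

text \<open>Take \<open>\<sigma> = 1\<close>, write \<open>e\<close> for the noise and let \<open>w = \<mu> - orth_proj (S m) (\<mu> + e)\<close> be the error of the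
least squares estimator on the model \<open>m\<close>. The residual of that fit is \<open>e + w\<close>, and both \<open>w\<close> and the model
lie in a subspace \<open>W\<close> of dimension \<open>dim (S m) + 1\<close> that contains \<open>\<mu>\<close>. Write \<open>U\<close> and \<open>V\<close> for the squared norms
of the components of \<open>e\<close> inside and orthogonal to \<open>W\<close>. Completing a square in \<open>W\<close> gives
\<open>(1 - 1 / K) * (norm w)\<^sup>2 \<le> (norm (e + w))\<^sup>2 - (norm e)\<^sup>2 + K * U\<close> (\<open>loss_le_residual_gain\<close>), and
\<open>V \<le> (norm (e + w))\<^sup>2\<close> (\<open>orth_proj_residual_le\<close>). At the selected model the squared residual is at most
\<open>crit_L\<close> of any competitor minus the penalty term, which is at least \<open>pen m * V / N\<close> with
\<open>N = codim (S m)\<close>. Hence the loss is at most \<open>K / (K - 1)\<close> times the sum of three terms: the criterion of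
the competitor minus \<open>(norm e)\<^sup>2\<close>, the constant \<open>c\<close>, and the positive part of \<open>K * U - pen m * V / N - c\<close> at
the selected model (\<open>normalized_loss_le\<close>).

The first term has as its mean exactly the bracket inside the infimum (\<open>std_gaussian_residual_mean\<close>).
The last one is bounded by its sum over all models, which frees it from the random index. By rotation
invariance \<open>U\<close> and \<open>V\<close> are independent chi-squared variables with \<open>dim (S m) + 1\<close> and \<open>N - 1\<close> degrees of
freedom (\<open>std_gaussian_projection_law\<close>). It remains to pass from \<open>pen m * V / N + c\<close> to
\<open>(pen m + c) * V / N\<close>, the form that occurs in \<open>Dkhi\<close>. Convexity of the positive part allows this: the
first-order correction is \<open>c\<close> times \<open>V / N - 1\<close>, whose mean is negative, weighted by an indicator that
depends on \<open>U\<close> only (\<open>excess_le_Dkhi\<close>).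

Rotation invariance of the Gaussian measure follows from that of Lebesgue measure
(\<open>lborel_orthogonal_invariant\<close>) because its density is a function of the norm.\<close>

section \<open>Orthogonal projections\<close>

lemma orth_proj_eqI:
  assumes "subspace S" "p \<in> S" "\<And>v. v \<in> S \<Longrightarrow> orthogonal (y - p) v"
  shows "orth_proj S y = p"
  unfolding orth_proj_def using orth_proj_unique_exists[OF assms(1), of y] assms(2,3)
  by (intro the1_equality) auto

lemma
  assumes "subspace S"
  shows orth_proj_in: "orth_proj S y \<in> S"
    and orth_proj_orthogonal: "v \<in> S \<Longrightarrow> (y - orth_proj S y) \<bullet> v = 0"
  using theI'[OF orth_proj_unique_exists[OF assms, of y]]
  by (auto simp: orth_proj_def orthogonal_def)

lemma linear_orth_proj:
  assumes S: "subspace S"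
  shows "linear (orth_proj S)"
proof (rule linearI)
  fix x y
  show "orth_proj S (x + y) = orth_proj S x + orth_proj S y"
    by (rule orth_proj_eqI[OF S])
      (auto simp: orthogonal_def subspace_add[OF S] orth_proj_in[OF S] add_diff_add inner_add_left
        orth_proj_orthogonal[OF S])
next
  fix c x
  show "orth_proj S (c *\<^sub>R x) = c *\<^sub>R orth_proj S x"
    by (rule orth_proj_eqI[OF S])
      (auto simp: orthogonal_def subspace_scale[OF S] orth_proj_in[OF S] scaleR_right_diff_distrib[symmetric]
        orth_proj_orthogonal[OF S])
qed

lemma borel_measurable_linear:
  fixes f :: "'a::euclidean_space \<Rightarrow> 'b::euclidean_space"
  assumes "linear f"
  shows "f \<in> borel_measurable borel"
  using assms linear_continuous_on linear_conv_bounded_linear by (blast intro: borel_measurable_continuous_onI)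

text \<open>Once \<open>e \<bullet> w\<close> is replaced by \<open>orth_proj W e \<bullet> w\<close>, which is legitimate because \<open>w\<close> lies in \<open>W\<close>, the
difference of the two sides is \<open>(norm (w + K *\<^sub>R orth_proj W e))\<^sup>2 / K\<close>. In the application \<open>e + w\<close> is
the residual of a least squares fit and \<open>w\<close> its estimation error, so that the cross term between
noise and error is paid for by the noise inside \<open>W\<close> alone.\<close>

lemma loss_le_residual_gain:
  fixes e w :: "'a::euclidean_space"
  assumes W: "subspace W" and w: "w \<in> W" and K: "K > 0"
  shows "(1 - 1 / K) * (norm w)\<^sup>2 \<le> (norm (e + w))\<^sup>2 - (norm e)\<^sup>2 + K * (norm (orth_proj W e))\<^sup>2"
proof -
  let ?p = "orth_proj W e"
  have ew: "e \<bullet> w = ?p \<bullet> w"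
    using orth_proj_orthogonal[OF W w, of e] by (simp add: inner_diff_left)
  have "0 \<le> (norm (w + K *\<^sub>R ?p))\<^sup>2 / K" using K by simp
  also have "\<dots> = (norm w)\<^sup>2 / K + 2 * (e \<bullet> w) + K * (norm ?p)\<^sup>2"
    using K by (simp add: ew power2_norm_eq_inner inner_simps inner_commute field_simps)
  finally show ?thesis
    by (simp add: power2_norm_eq_inner inner_simps inner_commute algebra_simps)
qed

text \<open>Moving \<open>e\<close> by a vector of \<open>W\<close> cannot bring it closer to the origin than its distance to \<open>W\<close>.\<close>

lemma orth_proj_residual_le:
  fixes e w :: "'a::euclidean_space"
  assumes W: "subspace W" and w: "w \<in> W"
  shows "(norm (e - orth_proj W e))\<^sup>2 \<le> (norm (e + w))\<^sup>2"
proof -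
  let ?p = "orth_proj W e"
  have "(e - ?p) \<bullet> (?p + w) = 0"
    by (intro orth_proj_orthogonal[OF W] subspace_add[OF W] orth_proj_in[OF W] w)
  then have "(norm ((e - ?p) + (?p + w)))\<^sup>2 = (norm (e - ?p))\<^sup>2 + (norm (?p + w))\<^sup>2"
    by (intro norm_add_Pythagorean) (simp add: orthogonal_def)
  then show ?thesis by simp
qed

text \<open>The error \<open>a - orth_proj S (a + e)\<close> of a least squares fit need not lie in \<open>S\<close>, but it lies in any subspace
that contains both \<open>S\<close> and the mean \<open>a\<close>; one extra dimension is enough for that. Adding a dimension
even when \<open>a\<close> already lies in \<open>S\<close> gives the same degrees of freedom for all positions of \<open>a\<close>.\<close>

lemma subspace_enlarge:
  fixes S :: "'a::euclidean_space set"
  assumes S: "subspace S" and "codim S \<ge> 1"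
  obtains W where "subspace W" "S \<subseteq> W" "a \<in> W" "dim W = dim S + 1" "codim W = codim S - 1"
proof -
  have "dim S < DIM('a)" using assms by (simp add: codim_def)
  then have "S \<noteq> UNIV" by (auto simp: dim_UNIV)
  then obtain x where x: "x \<notin> S" "a \<notin> S \<longrightarrow> x = a" by blast
  have "dim (span (insert x S)) = dim S + 1"
    using x S by (simp add: dim_insert span_eq_iff[THEN iffD2])
  moreover have "S \<subseteq> span (insert x S)" "a \<in> span (insert x S)"
    using x by (auto intro: span_base)
  ultimately show ?thesis
    by (intro that[of "span (insert x S)"]) (auto simp: codim_def)
qed

section \<open>Rotation invariance of Lebesgue measure\<close>

lemma lborel_translation_invariant:
  fixes a :: "'a::euclidean_space"
  shows "distr lborel borel ((+) a) = lborel"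
  using lborel_affine[of 1 a] by (simp add: density_1)

lemma nn_integral_lborel_translate:
  fixes a :: "'a::euclidean_space"
  assumes [measurable]: "f \<in> borel_measurable borel"
  shows "(\<integral>\<^sup>+x. f (a + x) \<partial>lborel) = (\<integral>\<^sup>+x. f x \<partial>lborel)"
proof -
  have "(\<integral>\<^sup>+x. f x \<partial>lborel) = (\<integral>\<^sup>+x. f x \<partial>distr lborel borel ((+) a))"
    by (simp only: lborel_translation_invariant)
  also have "\<dots> = (\<integral>\<^sup>+x. f (a + x) \<partial>lborel)"
    by (rule nn_integral_distr) simp_all
  finally show ?thesis ..
qed

text \<open>The uniqueness argument for Haar measure, applied to \<open>lborel\<close> and its image under \<open>f\<close>. With \<open>B\<close> the
unit ball, both \<open>emeasure lborel B * emeasure lborel (f -` E)\<close> and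
\<open>emeasure lborel B * emeasure lborel E\<close> are values of one double integral, by Fubini and
translation invariance. The image measure is translation invariant because \<open>f\<close> is additive and onto,
and the factor relating the two measures is 1 because \<open>f\<close> preserves \<open>B\<close>.\<close>

lemma lborel_orthogonal_invariant:
  fixes f :: "'a::euclidean_space \<Rightarrow> 'a"
  assumes f: "orthogonal_transformation f"
  shows "distr lborel borel f = lborel"
proof (rule measure_eqI)
  fix E assume "E \<in> sets (distr lborel borel f)"
  then have [measurable]: "E \<in> sets borel" by simp
  have lin: "linear f" using f by (rule orthogonal_transformation_linear)
  have [measurable]: "f \<in> borel_measurable borel"
    using lin by (rule borel_measurable_linear)
  define B where "B = ball (0::'a) 1"
  have [measurable]: "B \<in> sets borel" by (simp add: B_def)
  have B_f: "f y \<in> B \<longleftrightarrow> y \<in> B" "- y \<in> B \<longleftrightarrow> y \<in> B" for y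
    using f by (simp_all add: B_def orthogonal_transformation_norm)
  have B: "emeasure lborel B \<noteq> 0" "emeasure lborel B \<noteq> \<infinity>"
    by (simp_all add: B_def emeasure_ball ennreal_eq_0_iff not_le)
  have "emeasure lborel B * emeasure lborel (f -` E)
      = (\<integral>\<^sup>+y. indicator E (f y) * (\<integral>\<^sup>+x. indicator B x \<partial>lborel) \<partial>lborel)"
  proof -
    have "f -` E \<in> sets borel" using measurable_sets[of f borel borel E] by simp
    then have "(\<integral>\<^sup>+y. indicator E (f y) \<partial>lborel) = emeasure lborel (f -` E)"
      by (simp add: nn_integral_indicator[symmetric] indicator_def)
    then show ?thesis by (simp add: nn_integral_cmult mult.commute)
  qed
  also have "\<dots> = (\<integral>\<^sup>+y. indicator E (f y) * (\<integral>\<^sup>+x. indicator B (- f y + x) \<partial>lborel) \<partial>lborel)"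
    by (subst nn_integral_lborel_translate) auto
  also have "\<dots> = (\<integral>\<^sup>+y. (\<integral>\<^sup>+x. indicator E (f y) * indicator B (x - f y) \<partial>lborel) \<partial>lborel)"
    by (simp add: nn_integral_cmult[symmetric])
  also have "\<dots> = (\<integral>\<^sup>+x. (\<integral>\<^sup>+y. indicator E (f y) * indicator B (x - f y) \<partial>lborel) \<partial>lborel)"
    by (rule lborel_pair.Fubini') measurable
  also have "\<dots> = (\<integral>\<^sup>+x. (\<integral>\<^sup>+y. indicator E (x + f y) * indicator B y \<partial>lborel) \<partial>lborel)"
  proof (rule nn_integral_cong)
    fix x :: 'a
    \<comment> \<open>A translation by \<open>x\<close> after \<open>f\<close> is a translation by \<open>z\<close> before it.\<close>
    obtain z where z: "f z = x" using orthogonal_transformation_surj[OF f] by (metis surjD)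
    have "(\<integral>\<^sup>+y. indicator E (f y) * indicator B (x - f y) \<partial>lborel)
      = (\<integral>\<^sup>+y. indicator E (f (z + y)) * indicator B (x - f (z + y)) \<partial>lborel)"
      by (subst nn_integral_lborel_translate[where f="\<lambda>y. indicator E (f y) * indicator B (x - f y)"]) simp_all
    also have "\<dots> = (\<integral>\<^sup>+y. indicator E (x + f y) * indicator B y \<partial>lborel)"
      using B_f by (simp add: linear_add[OF lin] z indicator_def)
    finally show "(\<integral>\<^sup>+y. indicator E (f y) * indicator B (x - f y) \<partial>lborel)
      = (\<integral>\<^sup>+y. indicator E (x + f y) * indicator B y \<partial>lborel)" .
  qed
  also have "\<dots> = (\<integral>\<^sup>+y. (\<integral>\<^sup>+x. indicator E (x + f y) * indicator B y \<partial>lborel) \<partial>lborel)"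
    by (rule lborel_pair.Fubini') measurable
  also have "\<dots> = (\<integral>\<^sup>+y. (\<integral>\<^sup>+x. indicator E (f y + x) \<partial>lborel) * indicator B y \<partial>lborel)"
    by (simp add: nn_integral_multc add.commute)
  also have "\<dots> = emeasure lborel B * emeasure lborel E"
    by (subst nn_integral_lborel_translate) (simp_all add: nn_integral_multc mult.commute)
  finally have "emeasure lborel (f -` E) = emeasure lborel E"
    using B by (simp add: ennreal_mult_cancel_left)
  then show "emeasure (distr lborel borel f) E = emeasure lborel E"
    by (simp add: emeasure_distr)
qed simp

section \<open>The standard Gaussian measure\<close>

definition std_gaussian :: "(real ^ 'n) measure" where
  "std_gaussian = density lborel (\<lambda>x. ennreal (\<Prod>i\<in>UNIV. std_normal_density (x $ i)))"

lemma sets_std_gaussian [simp, measurable_cong]: "sets std_gaussian = sets borel"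
  by (simp add: std_gaussian_def)

lemma space_std_gaussian [simp]: "space std_gaussian = UNIV"
  by (simp add: std_gaussian_def)

text \<open>The product density depends on \<open>x\<close> through its norm only, which is where rotation invariance
comes from.\<close>

lemma std_gaussian_density_norm:
  fixes x :: "real ^ 'n"
  shows "(\<Prod>i\<in>UNIV. std_normal_density (x $ i))
    = (1 / sqrt (2 * pi)) ^ CARD('n) * exp (- (norm x)\<^sup>2 / 2)"
proof -
  have "(norm x)\<^sup>2 = (\<Sum>i\<in>UNIV. (x $ i)\<^sup>2)"
    by (simp add: norm_vec_def L2_set_def sum_nonneg)
  then show ?thesis
    by (simp add: std_normal_density_def prod.distrib exp_sum[symmetric] sum_divide_distrib sum_negf power_divide prod_dividef del: times_divide_eq_left)
qed

lemma std_gaussian_orthogonal_invariant: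
  fixes f :: "real ^ 'n \<Rightarrow> real ^ 'n"
  assumes f: "orthogonal_transformation f"
  shows "distr std_gaussian borel f = std_gaussian"
proof -
  have lin: "linear f" using f by (rule orthogonal_transformation_linear)
  have [measurable]: "f \<in> borel_measurable borel"
    using lin by (rule borel_measurable_linear)
  let ?g = "\<lambda>x :: real^'n. ennreal ((1 / sqrt (2 * pi)) ^ CARD('n) * exp (- (norm x)\<^sup>2 / 2))"
  have "density (distr lborel borel f) ?g = distr (density lborel (\<lambda>x. ?g (f x))) borel f"
    by (rule density_distr) simp_all
  then show ?thesis
    using f by (simp add: std_gaussian_def std_gaussian_density_norm lborel_orthogonal_invariant orthogonal_transformation_norm)
qed

abbreviation std_normal :: "real measure" where
  "std_normal \<equiv> density lborel std_normal_density"

lemma prob_space_std_normal: "prob_space std_normal"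
  by (rule prob_space_normal_density) simp

lemma borel_measurable_vec_lambda:
  fixes M :: "real measure"
  assumes [measurable_cong]: "sets M = sets borel"
  shows "(\<lambda>f. \<chi> i. f i) \<in> PiM (UNIV :: 'n::finite set) (\<lambda>_. M) \<rightarrow>\<^sub>M (borel :: (real ^ 'n) measure)"
  by (rule borel_measurable_euclidean_space[THEN iffD2]) (auto simp: Basis_vec_def inner_axis)

lemma distr_PiM_lborel_vec:
  "distr (PiM (UNIV :: 'n::finite set) (\<lambda>_. lborel)) borel (\<lambda>f. \<chi> i. f i) = (lborel :: (real ^ 'n) measure)"
proof (rule lborel_eqI[symmetric])
  interpret product_sigma_finite "\<lambda>_::'n. lborel :: real measure" by standard
  note [measurable] = borel_measurable_vec_lambda[of lborel]
  fix l u :: "real ^ 'n"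
  assume lu: "\<And>b. b \<in> Basis \<Longrightarrow> l \<bullet> b \<le> u \<bullet> b"
  have le: "l $ i \<le> u $ i" for i
    using lu[of "axis i 1"] by (auto simp: inner_axis Basis_vec_def)
  have "(\<lambda>f. \<chi> i. f i) -` box l u \<inter> space (PiM (UNIV :: 'n set) (\<lambda>_. lborel)) = PiE UNIV (\<lambda>i. {l $ i <..< u $ i})"
    by (auto simp: mem_box_cart space_PiM PiE_iff)
  then have "emeasure (distr (PiM (UNIV :: 'n::finite set) (\<lambda>_. lborel)) borel (\<lambda>f. \<chi> i. f i)) (box l u)
    = (\<Prod>i\<in>UNIV. ennreal (u $ i - l $ i))"
    using le by (simp add: emeasure_distr emeasure_PiM)
  also have "\<dots> = (\<Prod>b\<in>Basis. (u - l) \<bullet> b)"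
  proof -
    have Basis_eq: "(Basis :: (real ^ 'n) set) = (\<lambda>i. axis i 1) ` (UNIV :: 'n set)"
      by (auto simp: Basis_vec_def)
    have "inj (\<lambda>i::'n. axis i (1::real))" by (auto simp: inj_on_def axis_eq_axis)
    then have "(\<Prod>b\<in>Basis. (u - l) \<bullet> b) = (\<Prod>i\<in>UNIV. u $ i - l $ i)"
      unfolding Basis_eq by (simp add: prod.reindex inner_axis)
    then show ?thesis using le by (simp add: prod_ennreal)
  qed
  finally show "emeasure (distr (PiM (UNIV :: 'n::finite set) (\<lambda>_. lborel)) borel (\<lambda>f. \<chi> i. f i)) (box l u)
    = (\<Prod>b\<in>Basis. (u - l) \<bullet> b)" .
qed simp

text \<open>Links the two descriptions of the Gaussian vector: the density, in which rotation invariance is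
visible, and the product of coordinate laws, in which independence is visible.\<close>

lemma PiM_std_normal_eq_density:
  "PiM (UNIV :: 'n::finite set) (\<lambda>_. std_normal)
    = density (PiM UNIV (\<lambda>_. lborel)) (\<lambda>f. ennreal (\<Prod>i\<in>UNIV. std_normal_density (f i)))"
proof -
  interpret L: product_sigma_finite "\<lambda>_::'n. lborel :: real measure" by standard
  interpret G: product_prob_space "\<lambda>_::'n. std_normal" UNIV
    by (intro product_prob_spaceI prob_space_std_normal)
  show ?thesis
  proof (rule G.PiM_eqI[symmetric])
    fix A :: "'n \<Rightarrow> real set"
    assume "\<And>i. i \<in> UNIV \<Longrightarrow> A i \<in> sets std_normal"
    then have [measurable]: "A i \<in> sets borel" for i by simp
    have "emeasure (density (PiM UNIV (\<lambda>_. lborel)) (\<lambda>f. ennreal (\<Prod>i\<in>UNIV. std_normal_density (f i)))) (PiE UNIV A)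
      = (\<integral>\<^sup>+f. (\<Prod>i\<in>UNIV. ennreal (std_normal_density (f i)) * indicator (A i) (f i)) \<partial>PiM UNIV (\<lambda>_. lborel))"
      by (subst emeasure_density)
        (auto simp: prod.distrib prod_ennreal indicator_def PiE_iff intro!: nn_integral_cong sets_PiM_I_finite split: if_splits)
    also have "\<dots> = (\<Prod>i\<in>UNIV. \<integral>\<^sup>+x. ennreal (std_normal_density x) * indicator (A i) x \<partial>lborel)"
      by (rule L.product_nn_integral_prod) auto
    also have "\<dots> = (\<Prod>i\<in>UNIV. emeasure std_normal (A i))"
      by (simp add: emeasure_density)
    finally show "emeasure (density (PiM UNIV (\<lambda>_. lborel)) (\<lambda>f. ennreal (\<Prod>i\<in>UNIV. std_normal_density (f i)))) (PiE UNIV A)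
      = (\<Prod>i\<in>UNIV. emeasure std_normal (A i))" .
  qed (auto cong: sets_PiM_cong)
qed

lemma distr_PiM_std_normal:
  "distr (PiM (UNIV :: 'n::finite set) (\<lambda>_. std_normal)) borel (\<lambda>f. \<chi> i. f i) = std_gaussian"
proof -
  note [measurable] = borel_measurable_vec_lambda[of lborel]
  have "density (distr (PiM (UNIV :: 'n set) (\<lambda>_. lborel)) borel (\<lambda>f. \<chi> i. f i))
      (\<lambda>x. ennreal (\<Prod>i\<in>UNIV. std_normal_density (x $ i)))
    = distr (density (PiM UNIV (\<lambda>_. lborel)) (\<lambda>f. ennreal (\<Prod>i\<in>UNIV. std_normal_density ((\<chi> i. f i) $ i)))) borel (\<lambda>f. \<chi> i. f i)"
    by (rule density_distr) measurable
  then show ?thesis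
    by (simp add: std_gaussian_def distr_PiM_lborel_vec PiM_std_normal_eq_density)
qed

lemma prob_space_std_gaussian: "prob_space (std_gaussian :: (real ^ 'n) measure)"
  unfolding distr_PiM_std_normal[symmetric]
  by (intro prob_space.prob_space_distr prob_space_PiM prob_space_std_normal borel_measurable_vec_lambda) simp

lemma distr_noise_std_gaussian:
  fixes \<epsilon> :: "'n::finite \<Rightarrow> 'w \<Rightarrow> real"
  assumes "prob_space P"
    and indep: "prob_space.indep_vars P (\<lambda>_. borel) \<epsilon> UNIV"
    and d: "\<And>i. distributed P lborel (\<epsilon> i) std_normal_density"
  shows "(\<lambda>\<omega>. \<chi> i. \<epsilon> i \<omega>) \<in> borel_measurable P"
    and "distr P borel (\<lambda>\<omega>. \<chi> i. \<epsilon> i \<omega>) = std_gaussian"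
proof -
  interpret prob_space P by fact
  have [measurable]: "\<epsilon> i \<in> borel_measurable P" for i
    using distributed_measurable[OF d[of i]] by simp
  have m[measurable]: "(\<lambda>\<omega>. \<lambda>i\<in>UNIV. \<epsilon> i \<omega>) \<in> P \<rightarrow>\<^sub>M PiM UNIV (\<lambda>_. borel)"
    by (rule measurable_restrict) simp
  have v: "(\<lambda>f. \<chi> i. f i) \<in> PiM (UNIV :: 'n set) (\<lambda>_. borel) \<rightarrow>\<^sub>M (borel :: (real ^ 'n) measure)"
    by (rule borel_measurable_vec_lambda) simp
  show "(\<lambda>\<omega>. \<chi> i. \<epsilon> i \<omega>) \<in> borel_measurable P"
    using measurable_compose[OF m v] by simp
  have "distr P borel (\<epsilon> i) = std_normal" for i
  proof -
    have "distr P borel (\<epsilon> i) = distr P lborel (\<epsilon> i)" by (rule distr_cong) auto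
    then show ?thesis using distributed_distr_eq_density[OF d[of i]] by simp
  qed
  then have "distr P (PiM UNIV (\<lambda>_. borel)) (\<lambda>\<omega>. \<lambda>i\<in>UNIV. \<epsilon> i \<omega>) = PiM UNIV (\<lambda>_. std_normal)"
    using indep by (subst (asm) indep_vars_iff_distr_eq_PiM') auto
  then have "distr (distr P (PiM UNIV (\<lambda>_. borel)) (\<lambda>\<omega>. \<lambda>i\<in>UNIV. \<epsilon> i \<omega>)) borel (\<lambda>f. \<chi> i. f i) = std_gaussian"
    by (simp add: distr_PiM_std_normal)
  then show "distr P borel (\<lambda>\<omega>. \<chi> i. \<epsilon> i \<omega>) = std_gaussian"
    by (subst (asm) distr_distr[OF v m]) (simp add: o_def restrict_UNIV)
qed

section \<open>The law of the projections of a Gaussian vector\<close>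

text \<open>The law of a sum of squares depends on the index set through its cardinality only.\<close>

lemma distr_sum_squares_std_normal:
  assumes "finite I"
  shows "distr (PiM I (\<lambda>_. std_normal)) borel (\<lambda>z. \<Sum>i\<in>I. (z i)\<^sup>2) = chi_squared (card I)"
proof -
  obtain h where h: "bij_betw h {..<card I} I"
    using ex_bij_betw_nat_finite[OF assms] by (auto simp: atLeast0LessThan)
  have "chi_squared (card I) = distr (distr (PiM I (\<lambda>_. std_normal)) (PiM {..<card I} (\<lambda>_. std_normal))
      (\<lambda>\<omega>. \<lambda>n\<in>{..<card I}. \<omega> (h n))) borel (\<lambda>z. \<Sum>i<card I. (z i)\<^sup>2)"
    unfolding chi_squared_def using h
    by (subst distr_PiM_reindex[where K=I]) (auto simp: prob_space_std_normal bij_betw_def)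
  also have "\<dots> = distr (PiM I (\<lambda>_. std_normal)) borel (\<lambda>z. \<Sum>i<card I. (z (h i))\<^sup>2)"
  proof (subst distr_distr)
    show "(\<lambda>\<omega>. \<lambda>n\<in>{..<card I}. \<omega> (h n)) \<in> PiM I (\<lambda>_. std_normal) \<rightarrow>\<^sub>M PiM {..<card I} (\<lambda>_. std_normal)"
      using h by (intro measurable_restrict measurable_component_singleton) (auto simp: bij_betw_def)
  qed (auto simp: o_def intro!: distr_cong sum.cong)
  also have "\<dots> = distr (PiM I (\<lambda>_. std_normal)) borel (\<lambda>z. \<Sum>i\<in>I. (z i)\<^sup>2)"
    using h by (subst sum.reindex_bij_betw[OF h, symmetric]) simp
  finally show ?thesis ..
qed

lemma prob_space_chi_squared: "prob_space (chi_squared k)"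
  unfolding chi_squared_def
  by (intro prob_space.prob_space_distr prob_space_PiM prob_space_std_normal) simp

lemma sets_chi_squared [simp, measurable_cong]: "sets (chi_squared k) = sets borel"
  by (simp add: chi_squared_def)

text \<open>Disjoint groups of coordinates are independent, since the product over all coordinates is the image
under \<^const>\<open>merge\<close> of the product of the two partial products.\<close>

lemma std_gaussian_sum_squares_split:
  fixes I :: "'n::finite set"
  shows "distr std_gaussian (borel \<Otimes>\<^sub>M borel)
      (\<lambda>x. (\<Sum>i\<in>I. (x $ i)\<^sup>2, \<Sum>i\<in>-I. (x $ i)\<^sup>2))
    = chi_squared (card I) \<Otimes>\<^sub>M chi_squared (card (-I))"
proof -
  interpret product_prob_space "\<lambda>_::'n. std_normal" UNIV
    by (intro product_prob_spaceI prob_space_std_normal)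
  interpret C: prob_space "chi_squared (card (-I))" by (rule prob_space_chi_squared)
  note [measurable] = borel_measurable_vec_lambda[of std_normal]
  have m[measurable]: "merge I (-I) \<in> PiM I (\<lambda>_. std_normal) \<Otimes>\<^sub>M PiM (-I) (\<lambda>_. std_normal) \<rightarrow>\<^sub>M PiM UNIV (\<lambda>_. std_normal)"
    using measurable_merge[of I "-I" "\<lambda>_. std_normal"] by simp
  have "distr std_gaussian (borel \<Otimes>\<^sub>M borel)
      (\<lambda>x. (\<Sum>i\<in>I. (x $ i)\<^sup>2, \<Sum>i\<in>-I. (x $ i)\<^sup>2))
    = distr (PiM (UNIV::'n set) (\<lambda>_. std_normal)) (borel \<Otimes>\<^sub>M borel)
      (\<lambda>x. (\<Sum>i\<in>I. (x i)\<^sup>2, \<Sum>i\<in>-I. (x i)\<^sup>2))"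
    by (subst distr_PiM_std_normal[symmetric], subst distr_distr) (simp_all add: o_def)
  also have "\<dots> = distr (distr (PiM I (\<lambda>_. std_normal) \<Otimes>\<^sub>M PiM (-I) (\<lambda>_. std_normal)) 
       (PiM UNIV (\<lambda>_. std_normal)) (merge I (-I))) (borel \<Otimes>\<^sub>M borel)
      (\<lambda>x. (\<Sum>i\<in>I. (x i)\<^sup>2, \<Sum>i\<in>-I. (x i)\<^sup>2))"
    using distr_merge[of I "-I"] by simp
  also have "\<dots> = distr (PiM I (\<lambda>_. std_normal) \<Otimes>\<^sub>M PiM (-I) (\<lambda>_. std_normal)) (borel \<Otimes>\<^sub>M borel)
      (\<lambda>(x, y). (\<Sum>i\<in>I. (x i)\<^sup>2, \<Sum>i\<in>-I. (y i)\<^sup>2))"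
    by (subst distr_distr) (auto simp: o_def intro!: distr_cong)
  also have "\<dots> = distr (PiM I (\<lambda>_. std_normal)) borel (\<lambda>x. \<Sum>i\<in>I. (x i)\<^sup>2)
      \<Otimes>\<^sub>M distr (PiM (-I) (\<lambda>_. std_normal)) borel (\<lambda>x. \<Sum>i\<in>-I. (x i)\<^sup>2)"
    by (rule pair_measure_distr[symmetric]) (simp_all add: distr_sum_squares_std_normal C.sigma_finite_measure_axioms)
  finally show ?thesis by (simp add: distr_sum_squares_std_normal)
qed

text \<open>Orthonormal bases of \<open>W\<close> and of its orthogonal complement together form an orthonormal basis
indexed by the coordinates. Sending the standard basis to it turns the projection onto \<open>W\<close> into the
deletion of coordinates.\<close>

lemma adapted_orthogonal_transformation:
  fixes W :: "(real ^ 'n) set"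
  assumes W: "subspace W"
  obtains f :: "real ^ 'n \<Rightarrow> real ^ 'n" and I :: "'n set"
  where "orthogonal_transformation f" "card I = dim W"
    "\<And>y. orth_proj W (f y) = f (\<chi> i. if i \<in> I then y $ i else 0)"
proof -
  define W' where "W' = {y. \<forall>x\<in>W. orthogonal x y}"
  have "subspace W'" unfolding W'_def by (rule subspace_orthogonal_to_vectors)
  obtain B where B: "B \<subseteq> W" "pairwise orthogonal B" "\<And>x. x \<in> B \<Longrightarrow> norm x = 1" "independent B" "card B = dim W"
    by (rule orthonormal_basis_subspace[OF W]) blast
  obtain C where C: "C \<subseteq> W'" "pairwise orthogonal C" "\<And>x. x \<in> C \<Longrightarrow> norm x = 1" "independent C" "card C = dim W'"
    by (rule orthonormal_basis_subspace[OF \<open>subspace W'\<close>]) blast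
  have orth: "orthogonal x y" if "x \<in> W" "y \<in> W'" for x y using that by (simp add: W'_def)
  have fin: "finite B" "finite C" using B C independent_imp_finite by blast+
  have disj: "B \<inter> C = {}"
    using B C orth by (metis disjoint_iff norm_zero orthogonal_self subset_iff zero_neq_one)
  have "dim W' + dim W = CARD('n)"
    using dim_subspace_orthogonal_to_vectors[OF W subspace_UNIV] by (simp add: W'_def dim_UNIV)
  then have "card (B \<union> C) = CARD('n)" using B C fin disj by (simp add: card_Un_disjoint)
  then obtain h where h: "bij_betw h (UNIV::'n set) (B \<union> C)"
    using fin by (metis finite_UnI finite_class.finite_UNIV finite_same_card_bij)
  define I where "I = h -` B"
  have hI: "h ` I = B" using h by (auto simp: I_def bij_betw_def)
  have hB: "h i \<in> B" if "i \<in> I" for i using that by (simp add: I_def)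
  have hC: "h i \<in> C" if "i \<notin> I" for i using that h by (auto simp: I_def bij_betw_def)
  have inj: "inj h" using h by (simp add: bij_betw_def)
  have cardI: "card I = dim W" using B(5) hI inj by (metis card_image inj_on_subset subset_UNIV)
  have on: "h i \<bullet> h j = (if i = j then 1 else 0)" for i j
  proof (cases "i = j")
    case True
    then show ?thesis using B(3) C(3) hB hC norm_eq_1 by metis
  next
    case False
    then have "h i \<noteq> h j" using inj by (auto dest: injD)
    then have "orthogonal (h i) (h j)"
      using hB hC B(1,2) C(1,2) orth[of "h i" "h j"] orth[of "h j" "h i"]
      by (cases "i \<in> I"; cases "j \<in> I") (auto simp: pairwise_def orthogonal_commute subset_iff)
    then show ?thesis using False by (simp add: orthogonal_def)
  qed
  define f where "f y = (\<Sum>i\<in>UNIV. (y $ i) *\<^sub>R h i)" for y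
  have "linear f"
    by (rule linearI) (simp_all add: f_def scaleR_add_left sum.distrib scaleR_sum_right)
  moreover have "f x \<bullet> f y = x \<bullet> y" for x y
  proof -
    have "h i \<bullet> f y = y $ i" for i
      by (simp add: f_def inner_sum_right on if_distrib sum.delta cong: if_cong)
    then have "f x \<bullet> f y = (\<Sum>i\<in>UNIV. x $ i * y $ i)"
      by (subst f_def) (simp add: inner_sum_left)
    then show ?thesis by (simp add: inner_vec_def)
  qed
  ultimately have f: "orthogonal_transformation f" by (simp add: orthogonal_transformation_def)
  have proj: "orth_proj W (f y) = f (\<chi> i. if i \<in> I then y $ i else 0)" for y
  proof -
    let ?p = "f (\<chi> i. if i \<in> I then y $ i else 0)"
    have "?p \<in> W"
      unfolding f_def using B(1) hB
      by (intro subspace_sum[OF W]) (auto simp: subspace_0[OF W] intro!: subspace_scale[OF W])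
    moreover have "orthogonal (f y - ?p) v" if "v \<in> W" for v
    proof -
      have "f y - ?p = (\<Sum>i\<in>UNIV. (if i \<in> I then 0 else y $ i) *\<^sub>R h i)"
        unfolding f_def by (auto simp: sum_subtractf[symmetric] intro!: sum.cong)
      also have "\<dots> \<in> W'"
        using C(1) hC by (intro subspace_sum[OF \<open>subspace W'\<close>]) (auto simp: subspace_0[OF \<open>subspace W'\<close>] intro!: subspace_scale[OF \<open>subspace W'\<close>])
      finally show ?thesis using orth[OF that] orthogonal_commute by blast
    qed
    ultimately show ?thesis by (rule orth_proj_eqI[OF W])
  qed
  show ?thesis by (rule that[OF f cardI proj])
qed

text \<open>Cochran's theorem for two orthogonal components: a rotation adapted to \<open>W\<close> leaves the Gaussian law
unchanged and reduces the claim to the case of coordinate subspaces.\<close>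

lemma std_gaussian_projection_law:
  fixes W :: "(real ^ 'n) set"
  assumes W: "subspace W"
  shows "distr std_gaussian (borel \<Otimes>\<^sub>M borel)
      (\<lambda>x. ((norm (orth_proj W x))\<^sup>2, (norm (x - orth_proj W x))\<^sup>2))
    = chi_squared (dim W) \<Otimes>\<^sub>M chi_squared (codim W)"
proof -
  obtain f :: "real ^ 'n \<Rightarrow> real ^ 'n" and I :: "'n set"
    where f: "orthogonal_transformation f" and I: "card I = dim W"
    and proj: "\<And>y. orth_proj W (f y) = f (\<chi> i. if i \<in> I then y $ i else 0)"
    using adapted_orthogonal_transformation[OF W] by metis
  have lin: "linear f" using f by (rule orthogonal_transformation_linear)
  have sq: "(norm x)\<^sup>2 = (\<Sum>i\<in>UNIV. (x $ i)\<^sup>2)" for x :: "real ^ 'n"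
    by (simp add: norm_vec_def L2_set_def sum_nonneg)
  have n1: "(norm (orth_proj W (f y)))\<^sup>2 = (\<Sum>i\<in>I. (y $ i)\<^sup>2)" for y
    using f by (simp add: proj orthogonal_transformation_norm sq if_distrib[where f="\<lambda>t. t\<^sup>2"] sum.If_cases)
  have n2: "(norm (f y - orth_proj W (f y)))\<^sup>2 = (\<Sum>i\<in>-I. (y $ i)\<^sup>2)" for y
  proof -
    have "y - (\<chi> i. if i \<in> I then y $ i else 0) = (\<chi> i. if i \<in> I then 0 else y $ i)"
      by (simp add: vec_eq_iff)
    then have "f y - orth_proj W (f y) = f (\<chi> i. if i \<in> I then 0 else y $ i)"
      by (simp add: proj linear_diff[OF lin, symmetric])
    then show ?thesis
      using f by (simp add: orthogonal_transformation_norm sq if_distrib[where f="\<lambda>t. t\<^sup>2"] sum.If_cases)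
  qed
  have [measurable]: "f \<in> borel_measurable borel" "orth_proj W \<in> borel_measurable borel"
    using lin linear_orth_proj[OF W] by (simp_all add: borel_measurable_linear)
  have "distr std_gaussian (borel \<Otimes>\<^sub>M borel)
      (\<lambda>x. ((norm (orth_proj W x))\<^sup>2, (norm (x - orth_proj W x))\<^sup>2))
    = distr (distr std_gaussian borel f) (borel \<Otimes>\<^sub>M borel)
      (\<lambda>x. ((norm (orth_proj W x))\<^sup>2, (norm (x - orth_proj W x))\<^sup>2))"
    by (simp only: std_gaussian_orthogonal_invariant[OF f])
  also have "\<dots> = distr std_gaussian (borel \<Otimes>\<^sub>M borel) (\<lambda>x. (\<Sum>i\<in>I. (x $ i)\<^sup>2, \<Sum>i\<in>-I. (x $ i)\<^sup>2))"
    by (subst distr_distr) (simp_all add: o_def n1 n2)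
  also have "\<dots> = chi_squared (dim W) \<Otimes>\<^sub>M chi_squared (codim W)"
  proof -
    have "card (- I) = codim W" by (simp add: I Compl_eq_Diff_UNIV card_Diff_subset codim_def)
    then show ?thesis by (simp add: std_gaussian_sum_squares_split I)
  qed
  finally show ?thesis .
qed

section \<open>Moments of chi-squared variables\<close>

lemma has_bochner_integral_distr_iff:
  fixes f :: "'a \<Rightarrow> 'b::{banach, second_countable_topology}"
  assumes "f \<in> borel_measurable N" "g \<in> measurable M N"
  shows "has_bochner_integral (distr M N g) f x \<longleftrightarrow> has_bochner_integral M (\<lambda>x. f (g x)) x"
  using assms by (simp add: has_bochner_integral_iff integrable_distr_eq integral_distr)

lemma integrable_std_normal_square: "integrable std_normal (\<lambda>x. x\<^sup>2)"
  and integral_std_normal_square: "(\<integral>x. x\<^sup>2 \<partial>std_normal) = 1"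
  using integrable_std_normal_moment[of 2] integral_std_normal_moment_even[of 1]
  by (simp_all add: integrable_density integral_density)

lemma has_bochner_integral_chi_squared:
  "has_bochner_integral (chi_squared k) (\<lambda>u. u) (real k)"
proof -
  have comp: "has_bochner_integral (PiM {..<k} (\<lambda>_. std_normal)) (\<lambda>z. (z i)\<^sup>2) 1" if "i < k" for i
  proof -
    have "distr (PiM {..<k} (\<lambda>_. std_normal)) std_normal (\<lambda>z. z i) = std_normal"
      using that by (intro distr_PiM_component prob_space_std_normal) auto
    moreover have "has_bochner_integral std_normal (\<lambda>x. x\<^sup>2) 1"
      by (simp add: has_bochner_integral_iff integrable_std_normal_square integral_std_normal_square)
    ultimately have "has_bochner_integral (distr (PiM {..<k} (\<lambda>_. std_normal)) std_normal (\<lambda>z. z i)) (\<lambda>x. x\<^sup>2) 1"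
      by simp
    then show ?thesis
      using that by (subst (asm) has_bochner_integral_distr_iff) (auto intro!: measurable_component_singleton)
  qed
  have "has_bochner_integral (PiM {..<k} (\<lambda>_. std_normal)) (\<lambda>z. \<Sum>i<k. (z i)\<^sup>2) (\<Sum>i<k. 1)"
    by (intro has_bochner_integral_sum comp) simp
  then show ?thesis
    unfolding chi_squared_def by (subst has_bochner_integral_distr_iff) simp_all
qed

lemma integrable_chi_squared: "integrable (chi_squared k) (\<lambda>u. u)"
  and integral_chi_squared: "(\<integral>u. u \<partial>chi_squared k) = real k"
  using has_bochner_integral_chi_squared by (auto simp: has_bochner_integral_iff)

lemma
  shows integrable_chi_squared_pair_fst: "integrable (chi_squared D \<Otimes>\<^sub>M chi_squared k) fst"
    and integrable_chi_squared_pair_snd: "integrable (chi_squared D \<Otimes>\<^sub>M chi_squared k) snd"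
    and integral_chi_squared_pair_fst: "integral\<^sup>L (chi_squared D \<Otimes>\<^sub>M chi_squared k) fst = real D"
    and integral_chi_squared_pair_snd: "integral\<^sup>L (chi_squared D \<Otimes>\<^sub>M chi_squared k) snd = real k"
proof -
  interpret D: prob_space "chi_squared D" by (rule prob_space_chi_squared)
  interpret k: prob_space "chi_squared k" by (rule prob_space_chi_squared)
  interpret pair_prob_space "chi_squared D" "chi_squared k" by standard
  show fst: "integrable (chi_squared D \<Otimes>\<^sub>M chi_squared k) fst"
    using integrable_chi_squared[of D] by (intro Fubini_integrable) (auto simp: k.prob_space)
  show snd: "integrable (chi_squared D \<Otimes>\<^sub>M chi_squared k) snd"
    using integrable_chi_squared[of k] by (intro Fubini_integrable) auto
  show "integral\<^sup>L (chi_squared D \<Otimes>\<^sub>M chi_squared k) fst = real D"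
    using integral_fst'[OF fst] by (simp add: integral_chi_squared k.prob_space)
  show "integral\<^sup>L (chi_squared D \<Otimes>\<^sub>M chi_squared k) snd = real k"
    using integral_fst'[OF snd] by (simp add: integral_chi_squared D.prob_space)
qed

lemma Dkhi_nonneg: "Dkhi D k x \<ge> 0"
  unfolding Dkhi_def integral_chi_squared by (intro mult_nonneg_nonneg Bochner_Integration.integral_nonneg) auto

text \<open>The two positive parts differ in having \<open>c\<close> on the left where \<open>c * t\<close> stands on the right, and the last
term pays for that. For a fixed \<open>t\<close>, convexity of the positive part would give this bound with slope
\<open>of_bool (0 \<le> a - p * t - c)\<close>. As this slope decreases in \<open>t\<close>, replacing it by its value at \<open>t = 1\<close>
only increases its product with \<open>t - 1\<close>; the resulting slope no longer depends on \<open>t\<close>.\<close>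

lemma positive_part_subgradient:
  fixes a p c t :: real
  assumes "p \<ge> 0" "c \<ge> 0"
  shows "max 0 (a - p * t - c) \<le> max 0 (a - (p + c) * t) + of_bool (p + c \<le> a) * (c * (t - 1))"
proof (cases "t \<le> 1")
  case True
  then have "p * t \<le> p" "c * t \<le> c" using assms by (simp_all add: mult_left_le)
  then show ?thesis by (auto simp: algebra_simps max_def)
next
  case False
  then have "p * t \<ge> p" "c * t \<ge> c"
    using assms mult_left_mono[of 1 t p] mult_left_mono[of 1 t c] by simp_all
  then show ?thesis by (auto simp: algebra_simps max_def)
qed

text \<open>The threshold \<open>c\<close> is a constant on the left, while in \<^const>\<open>Dkhi\<close> it is multiplied by
\<open>v / (k + 1)\<close>. By the preceding inequality, taken at \<open>t = v / (k + 1)\<close>, the exchange costs \<open>c\<close> times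
the mean of \<open>t - 1\<close> weighted by a function of \<open>u\<close>. Since \<open>u\<close> and \<open>v\<close> are independent and \<open>v\<close> has mean
\<open>k < k + 1\<close>, this cost is not positive.\<close>

lemma excess_le_Dkhi:
  fixes K p c :: real
  assumes "K > 0" "p \<ge> 0" "c \<ge> 0" "D > 0" "k > 0"
  shows "integrable (chi_squared D \<Otimes>\<^sub>M chi_squared k)
      (\<lambda>(u, v). max 0 (K * u - p * (v / real (k + 1)) - c))" (is ?int)
    and "(\<integral>(u, v). max 0 (K * u - p * (v / real (k + 1)) - c) \<partial>(chi_squared D \<Otimes>\<^sub>M chi_squared k))
      \<le> K * (real D * Dkhi D k (real k / (K * real (k + 1)) * (p + c)))" (is "?lhs \<le> ?rhs")
proof -
  interpret D: prob_space "chi_squared D" by (rule prob_space_chi_squared)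
  interpret k: prob_space "chi_squared k" by (rule prob_space_chi_squared)
  interpret Q: pair_prob_space "chi_squared D" "chi_squared k" by standard
  let ?Q = "chi_squared D \<Otimes>\<^sub>M chi_squared k"
  define N where "N = real (k + 1)"
  have N: "N > 0" by (simp add: N_def)
  \<comment> \<open>The slope of the subgradient bound at \<open>a = K * u\<close>; it is a function of \<open>u\<close> alone.\<close>
  define s where "s u = (of_bool (p + c \<le> K * u) :: real)" for u
  have [measurable]: "s \<in> borel_measurable borel" unfolding s_def by measurable
  have int_affine: "integrable ?Q (\<lambda>x. max 0 (a * fst x - b * (snd x / N) - d))" for a b d
    using integrable_chi_squared_pair_fst[of D k] integrable_chi_squared_pair_snd[of D k]
    by (intro integrable_max Bochner_Integration.integrable_diff integrable_mult_right integrable_divide) auto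
  then show ?int by (simp add: case_prod_unfold N_def)
  have int_s: "integrable ?Q (\<lambda>x. s (fst x) * (c * (snd x / N - 1)))"
  proof (rule Bochner_Integration.integrable_bound)
    show "integrable ?Q (\<lambda>x. c * (snd x / N - 1))"
      using integrable_chi_squared_pair_snd[of D k] by (intro integrable_mult_right Bochner_Integration.integrable_diff integrable_divide) auto
  qed (auto simp: s_def abs_mult)
  have inner: "(\<integral>v. s u * (c * (v / N - 1)) \<partial>chi_squared k) = s u * (c * (- 1 / N))" for u
  proof -
    have "(\<integral>v. c * (v / N - 1) \<partial>chi_squared k) = c * (real k / N - 1)"
      using integrable_chi_squared[of k] by (simp add: integral_chi_squared k.prob_space)
    moreover have "real k / N - 1 = - 1 / N" by (simp add: N_def field_simps)
    ultimately show ?thesis by (simp only: integral_mult_right_zero)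
  qed
  have "(\<integral>x. s (fst x) * (c * (snd x / N - 1)) \<partial>?Q) = (\<integral>u. s u * (c * (- 1 / N)) \<partial>chi_squared D)"
    using Q.integral_fst'[OF int_s] by (simp only: fst_conv snd_conv inner)
  also have "\<dots> = - (\<integral>u. s u * (c / N) \<partial>chi_squared D)" by simp
  also have "\<dots> \<le> 0"
    using N assms unfolding neg_le_0_iff_le
    by (intro Bochner_Integration.integral_nonneg) (auto simp: s_def)
  finally have neg: "(\<integral>x. s (fst x) * (c * (snd x / N - 1)) \<partial>?Q) \<le> 0" .
  have pointwise: "max 0 (K * fst x - p * (snd x / N) - c)
      \<le> max 0 (K * fst x - (p + c) * (snd x / N) - 0) + s (fst x) * (c * (snd x / N - 1))" for x
    using positive_part_subgradient[OF assms(2,3), of "K * fst x" "snd x / N"] by (simp only: s_def diff_0_right)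
  have "?lhs = (\<integral>x. max 0 (K * fst x - p * (snd x / N) - c) \<partial>?Q)"
    by (simp add: case_prod_unfold N_def)
  also have "\<dots> \<le> (\<integral>x. max 0 (K * fst x - (p + c) * (snd x / N) - 0) + s (fst x) * (c * (snd x / N - 1)) \<partial>?Q)"
    by (intro integral_mono Bochner_Integration.integrable_add int_affine int_s pointwise)
  also have "\<dots> = (\<integral>x. max 0 (K * fst x - (p + c) * (snd x / N) - 0) \<partial>?Q) + (\<integral>x. s (fst x) * (c * (snd x / N - 1)) \<partial>?Q)"
    by (intro Bochner_Integration.integral_add int_affine int_s)
  also have "\<dots> \<le> (\<integral>x. max 0 (K * fst x - (p + c) * (snd x / N) - 0) \<partial>?Q)"
    using neg by simp
  also have "\<dots> = (\<integral>x. K * max 0 (fst x - real k / (K * N) * (p + c) * (snd x / real k)) \<partial>?Q)"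
  proof (rule Bochner_Integration.integral_cong[OF refl])
    fix x :: "real \<times> real"
    have "K * (fst x - real k / (K * N) * (p + c) * (snd x / real k)) = K * fst x - (p + c) * (snd x / N) - 0"
      using assms N by (simp add: field_simps)
    then show "max 0 (K * fst x - (p + c) * (snd x / N) - 0) = K * max 0 (fst x - real k / (K * N) * (p + c) * (snd x / real k))"
      using assms by (simp add: max_mult_distrib_left)
  qed
  also have "\<dots> = ?rhs"
    using assms by (simp add: Dkhi_def integral_chi_squared case_prod_unfold N_def)
  finally show "?lhs \<le> ?rhs" .
qed

section \<open>Gaussian means of residuals and excesses\<close>

lemma std_gaussian_projection_moments:
  fixes W :: "(real ^ 'n) set"
  assumes W: "subspace W"
  shows "has_bochner_integral std_gaussian (\<lambda>x. (norm (orth_proj W x))\<^sup>2) (real (dim W))"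
    and "has_bochner_integral std_gaussian (\<lambda>x. (norm (x - orth_proj W x))\<^sup>2) (real (codim W))"
proof -
  note [measurable] = borel_measurable_linear[OF linear_orth_proj[OF W]]
  have "has_bochner_integral (chi_squared (dim W) \<Otimes>\<^sub>M chi_squared (codim W)) fst (real (dim W))"
    and "has_bochner_integral (chi_squared (dim W) \<Otimes>\<^sub>M chi_squared (codim W)) snd (real (codim W))"
    by (simp_all add: has_bochner_integral_iff integrable_chi_squared_pair_fst integrable_chi_squared_pair_snd
       integral_chi_squared_pair_fst integral_chi_squared_pair_snd)
  then show "has_bochner_integral std_gaussian (\<lambda>x. (norm (orth_proj W x))\<^sup>2) (real (dim W))"
    and "has_bochner_integral std_gaussian (\<lambda>x. (norm (x - orth_proj W x))\<^sup>2) (real (codim W))"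
    unfolding std_gaussian_projection_law[OF W, symmetric]
    by (simp_all add: has_bochner_integral_distr_iff)
qed

lemma std_gaussian_norm_square:
  "has_bochner_integral (std_gaussian :: (real ^ 'n) measure) (\<lambda>x. (norm x)\<^sup>2) (real CARD('n))"
proof -
  have "orth_proj UNIV x = x" for x :: "real ^ 'n"
    by (rule orth_proj_eqI) (auto simp: orthogonal_def)
  then show ?thesis
    using std_gaussian_projection_moments(1)[of "UNIV :: (real ^ 'n) set"] by (simp add: dim_UNIV)
qed

text \<open>The mean vanishes because the law is symmetric under \<open>x \<mapsto> - x\<close>.\<close>

lemma std_gaussian_inner:
  fixes a :: "real ^ 'n"
  shows "has_bochner_integral std_gaussian (\<lambda>x. a \<bullet> x) 0"
proof -
  have int: "integrable std_gaussian (\<lambda>x. a \<bullet> x)"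
  proof (rule Bochner_Integration.integrable_bound)
    interpret prob_space "std_gaussian :: (real ^ 'n) measure" by (rule prob_space_std_gaussian)
    have "integrable std_gaussian (\<lambda>x :: real ^ 'n. (norm x)\<^sup>2)"
      using std_gaussian_norm_square by (rule integrable.intros)
    moreover have "integrable std_gaussian (\<lambda>x :: real ^ 'n. (norm a)\<^sup>2)" by simp
    ultimately show "integrable std_gaussian (\<lambda>x :: real ^ 'n. (norm a)\<^sup>2 + (norm x)\<^sup>2)" by simp
    show "AE x :: real ^ 'n in std_gaussian. norm (a \<bullet> x) \<le> norm ((norm a)\<^sup>2 + (norm x)\<^sup>2)"
    proof (rule AE_I2)
      fix x
      have "norm (a \<bullet> x) \<le> norm a * norm x" by (simp add: Cauchy_Schwarz_ineq2)
      also have "\<dots> \<le> (norm a)\<^sup>2 + (norm x)\<^sup>2"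
        using sum_squares_bound[of "norm a" "norm x"]
          mult_nonneg_nonneg[OF norm_ge_zero[of a] norm_ge_zero[of x]] by linarith
      finally show "norm (a \<bullet> x) \<le> norm ((norm a)\<^sup>2 + (norm x)\<^sup>2)" by simp
    qed
  qed simp
  have "(\<integral>x. a \<bullet> x \<partial>std_gaussian) = (\<integral>x. a \<bullet> x \<partial>distr std_gaussian borel uminus)"
    by (simp add: std_gaussian_orthogonal_invariant orthogonal_transformation_neg)
  also have "\<dots> = - (\<integral>x. a \<bullet> x \<partial>std_gaussian)"
    by (subst integral_distr) simp_all
  finally show ?thesis using int by (simp add: has_bochner_integral_iff)
qed

text \<open>The residual of \<open>\<nu> + x\<close> is the bias \<open>\<nu> - orth_proj S \<nu>\<close> plus the residual of \<open>x\<close>. The cross term is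
linear in \<open>x\<close> and has mean zero; the noise contributes one unit per dimension of the orthogonal
complement of \<open>S\<close>.\<close>

lemma std_gaussian_residual_mean:
  fixes \<nu> :: "real ^ 'n" and S :: "(real ^ 'n) set"
  assumes S: "subspace S"
  shows "has_bochner_integral std_gaussian (\<lambda>x. (norm (\<nu> + x - orth_proj S (\<nu> + x)))\<^sup>2)
    ((norm (\<nu> - orth_proj S \<nu>))\<^sup>2 + real (codim S))"
proof -
  let ?a = "\<nu> - orth_proj S \<nu>"
  have "(norm (\<nu> + x - orth_proj S (\<nu> + x)))\<^sup>2
     = (norm ?a)\<^sup>2 + 2 * (?a \<bullet> x) + (norm (x - orth_proj S x))\<^sup>2" for x
  proof -
    have "\<nu> + x - orth_proj S (\<nu> + x) = ?a + (x - orth_proj S x)"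
      by (simp add: linear_add[OF linear_orth_proj[OF S]])
    moreover have "?a \<bullet> orth_proj S x = 0"
      by (intro orth_proj_orthogonal[OF S] orth_proj_in[OF S])
    moreover have "(norm (?a + z))\<^sup>2 = (norm ?a)\<^sup>2 + 2 * (?a \<bullet> z) + (norm z)\<^sup>2" for z
      by (simp add: power2_norm_eq_inner inner_add_left inner_add_right inner_commute)
    ultimately show ?thesis by (simp only: inner_diff_right diff_0_right)
  qed
  moreover have "has_bochner_integral (std_gaussian :: (real^'n) measure) (\<lambda>x. (norm ?a)\<^sup>2) ((norm ?a)\<^sup>2)"
  proof -
    interpret prob_space "std_gaussian :: (real ^ 'n) measure" by (rule prob_space_std_gaussian)
    show ?thesis by (simp add: has_bochner_integral_iff prob_space[simplified])
  qed
  then have "has_bochner_integral std_gaussian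
      (\<lambda>x. (norm ?a)\<^sup>2 + 2 * (?a \<bullet> x) + (norm (x - orth_proj S x))\<^sup>2) ((norm ?a)\<^sup>2 + 2 * 0 + real (codim S))"
    by (intro has_bochner_integral_add has_bochner_integral_mult_right std_gaussian_inner
        std_gaussian_projection_moments[OF S]) auto
  ultimately show ?thesis by simp
qed

text \<open>The amount by which \<open>K\<close> times the noise captured by \<open>W\<close> exceeds the threshold \<open>c\<close> plus the part of the
penalty that noise outside \<open>W\<close> guarantees.\<close>

definition excess :: "real \<Rightarrow> real \<Rightarrow> real \<Rightarrow> nat \<Rightarrow> (real ^ 'n) set \<Rightarrow> real ^ 'n \<Rightarrow> real" where
  "excess K c p N W x =
     max 0 (K * (norm (orth_proj W x))\<^sup>2 - p * ((norm (x - orth_proj W x))\<^sup>2 / real N) - c)"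

lemma std_gaussian_excess:
  fixes W :: "(real ^ 'n) set"
  assumes W: "subspace W" and "K > 0" "p \<ge> 0" "c \<ge> 0" "dim W > 0" "codim W > 0"
  shows "integrable std_gaussian (excess K c p (codim W + 1) W)"
    and "(\<integral>x. excess K c p (codim W + 1) W x \<partial>std_gaussian)
      \<le> K * (real (dim W) * Dkhi (dim W) (codim W) (real (codim W) / (K * real (codim W + 1)) * (p + c)))"
proof -
  note [measurable] = borel_measurable_linear[OF linear_orth_proj[OF W]]
  let ?f = "\<lambda>(u, v). max 0 (K * u - p * (v / real (codim W + 1)) - c)"
  let ?g = "\<lambda>x :: real ^ 'n. ((norm (orth_proj W x))\<^sup>2, (norm (x - orth_proj W x))\<^sup>2)"
  have e: "excess K c p (codim W + 1) W = (\<lambda>x. ?f (?g x))" by (simp add: excess_def fun_eq_iff)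
  have f: "?f \<in> borel_measurable (borel \<Otimes>\<^sub>M borel)" by measurable
  have g: "?g \<in> std_gaussian \<rightarrow>\<^sub>M borel \<Otimes>\<^sub>M borel" by measurable
  note bounds = excess_le_Dkhi[OF assms(2-6), folded std_gaussian_projection_law[OF W]]
  show "integrable std_gaussian (excess K c p (codim W + 1) W)"
    unfolding e using bounds(1) by (subst (asm) integrable_distr_eq[OF g f])
  show "(\<integral>x. excess K c p (codim W + 1) W x \<partial>std_gaussian)
      \<le> K * (real (dim W) * Dkhi (dim W) (codim W) (real (codim W) / (K * real (codim W + 1)) * (p + c)))"
    unfolding e using bounds(2) by (subst (asm) integral_distr[OF g f])
qed

section \<open>Countable sums over the models\<close>

lemma borel_measurable_nn_integral_countable:
  fixes f :: "'i \<Rightarrow> 'a \<Rightarrow> ennreal"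
  assumes "countable I" and "\<And>i. i \<in> I \<Longrightarrow> f i \<in> borel_measurable M"
  shows "(\<lambda>x. \<integral>\<^sup>+i. f i x \<partial>count_space I) \<in> borel_measurable M"
proof -
  interpret sigma_finite_measure "count_space I"
    using assms(1) by (rule sigma_finite_measure_count_space_countable)
  have "(\<lambda>(i, x). f i x) \<in> borel_measurable (count_space I \<Otimes>\<^sub>M M)"
    using assms by (intro measurable_pair_measure_countable1) simp_all
  then have "(\<lambda>(x, i). f i x) \<in> borel_measurable (M \<Otimes>\<^sub>M count_space I)"
    by (subst measurable_pair_swap_iff) (simp add: case_prod_unfold)
  then show ?thesis by (rule borel_measurable_nn_integral)
qed

text \<open>Exchanging the sum over the models with the expectation is convenient for integrals against
\<^const>\<open>count_space\<close>; this lemma returns to an \<open>ereal\<close>-valued infinite sum when that sum is finite.\<close>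

lemma nn_integral_count_space_le_infsum:
  fixes g :: "'i \<Rightarrow> real"
  assumes nn: "\<And>i. i \<in> I \<Longrightarrow> 0 \<le> g i" and r: "(\<Sum>\<^sub>\<infinity>i\<in>I. ereal (g i)) = ereal r"
  shows "(\<integral>\<^sup>+i. ennreal (g i) \<partial>count_space I) \<le> ennreal r"
proof -
  have fin: "sum g F \<le> r" if "finite F" "F \<subseteq> I" for F
  proof -
    have "ereal (sum g F) \<le> (SUP F\<in>{F. finite F \<and> F \<subseteq> I}. \<Sum>i\<in>F. ereal (g i))"
      using that by (intro SUP_upper2[of F]) auto
    also have "\<dots> = ereal r"
      using nn r by (subst nonneg_infsum_complete[symmetric]) auto
    finally show ?thesis by simp
  qed
  have sm: "g summable_on I"
    using nn fin by (intro nonneg_bdd_above_summable_on) (auto simp: bdd_above_def)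
  then have "(\<lambda>i. norm (g i)) summable_on I"
    using nn by (simp cong: summable_on_cong)
  then have "Infinite_Set_Sum.abs_summable_on g I"
    by (simp add: abs_summable_equivalent[symmetric])
  then have "(\<integral>\<^sup>+i. ennreal (g i) \<partial>count_space I) = ennreal (infsum g I)"
    using nn by (simp add: nn_integral_conv_infsetsum infsetsum_infsum)
  also have "infsum g I \<le> r" using sm fin by (intro infsum_le_finite_sums) auto
  finally show ?thesis by (simp add: ennreal_leI)
qed

lemma ereal_le_mult_INF_add:
  fixes b :: "'i \<Rightarrow> real"
  assumes "I \<noteq> {}" "k > 0" "x \<noteq> - \<infinity>" and le: "\<And>i. i \<in> I \<Longrightarrow> x \<le> ereal (k * b i + s)"
  shows "x \<le> ereal k * (INF i\<in>I. ereal (b i)) + ereal s"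
proof -
  obtain j where j: "j \<in> I" using assms by blast
  obtain y where y: "x = ereal y" using le[OF j] assms(3) by (cases x) auto
  have "ereal ((y - s) / k) \<le> (INF i\<in>I. ereal (b i))"
    using le assms(2) by (intro INF_greatest) (simp add: y pos_divide_le_eq algebra_simps)
  moreover have "(INF i\<in>I. ereal (b i)) \<le> ereal (b j)" using j by (rule INF_lower)
  ultimately obtain i where "(INF i\<in>I. ereal (b i)) = ereal i" "(y - s) / k \<le> i"
    by (cases "INF i\<in>I. ereal (b i)") auto
  then show ?thesis using assms(2) by (simp add: y pos_divide_le_eq algebra_simps)
qed

section \<open>The oracle inequality\<close>

text \<open>A pathwise bound with unit noise level. The error \<open>w\<close> of the fit lies in \<open>W\<close> and the residual is \<open>e + w\<close>,
so \<open>loss_le_residual_gain\<close> bounds the loss by the squared residual. The squared residual equals the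
criterion minus the penalty term, and the penalty term is bounded below by \<open>orth_proj_residual_le\<close>.
What the criterion does not account for is at most \<open>c\<close> plus the excess of the model.\<close>

lemma normalized_loss_le:
  fixes \<nu> e :: "real ^ 'n"
  assumes S: "subspace (S m)" and W: "subspace W" "S m \<subseteq> W" "\<nu> \<in> W"
    and "K > 0" "pen m \<ge> 0"
    and le: "crit_L S pen (\<nu> + e) m \<le> L"
  shows "(1 - 1 / K) * (norm (\<nu> - orth_proj (S m) (\<nu> + e)))\<^sup>2
    \<le> L - (norm e)\<^sup>2 + c + excess K c (pen m) (codim (S m)) W e"
proof -
  let ?w = "\<nu> - orth_proj (S m) (\<nu> + e)"
  have w: "?w \<in> W" using W orth_proj_in[OF S, of "\<nu> + e"] by (auto intro: subspace_diff)
  have res: "\<nu> + e - orth_proj (S m) (\<nu> + e) = e + ?w" by simp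
  have "pen m * ((norm (e - orth_proj W e))\<^sup>2 / real (codim (S m)))
      \<le> pen m * ((norm (e + ?w))\<^sup>2 / real (codim (S m)))"
    using orth_proj_residual_le[OF W(1) w, of e] assms by (intro mult_left_mono divide_right_mono) auto
  moreover have "(norm (e + ?w))\<^sup>2 + pen m * ((norm (e + ?w))\<^sup>2 / real (codim (S m))) \<le> L"
    using le unfolding crit_L_def res by (simp add: algebra_simps)
  moreover have "(1 - 1 / K) * (norm ?w)\<^sup>2 \<le> (norm (e + ?w))\<^sup>2 - (norm e)\<^sup>2 + K * (norm (orth_proj W e))\<^sup>2"
    using assms by (intro loss_le_residual_gain[OF W(1) w])
  ultimately show ?thesis by (simp add: excess_def)
qed

text \<open>The pathwise bound holds at the random index \<open>mhat \<omega>\<close>, whose excess is dominated by the sum of the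
excesses of all models; this removes the random index from the right-hand side and makes it
measurable. For the fixed model \<open>m\<close>, the criterion minus the squared noise has
exactly the announced mean. The left-hand integrand may fail to be measurable because \<open>mhat\<close> is
arbitrary; the only property of its integral in the proof is monotonicity, which holds regardless.\<close>

lemma normalized_oracle_inequality:
  fixes P :: "'w measure" and E :: "'w \<Rightarrow> real ^ 'n" and \<nu> :: "real ^ 'n"
    and S :: "'m \<Rightarrow> (real ^ 'n) set"
  assumes "prob_space P"
    and E[measurable]: "E \<in> borel_measurable P" and law: "distr P borel E = std_gaussian"
    and cnt: "countable \<M>"
    and S: "\<And>m. m \<in> \<M> \<Longrightarrow> subspace (S m)"
    and cod: "\<And>m. m \<in> \<M> \<Longrightarrow> codim (S m) \<ge> 2"
    and pen: "\<And>m. m \<in> \<M> \<Longrightarrow> pen m \<ge> 0"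
    and mhat: "AE \<omega> in P. mhat \<omega> \<in> \<M> \<and>
           (\<forall>m\<in>\<M>. crit_L S pen (\<nu> + E \<omega>) (mhat \<omega>) \<le> crit_L S pen (\<nu> + E \<omega>) m)"
    and c: "c \<ge> 0" and K: "K > 1"
    and r: "(\<Sum>\<^sub>\<infinity>m\<in>\<M>. ereal (real (dim (S m) + 1) * Dkhi (dim (S m) + 1) (codim (S m) - 1)
            (real (codim (S m) - 1) / (K * real (codim (S m))) * (pen m + c)))) = ereal r"
    and m: "m \<in> \<M>"
  shows "enn2ereal (\<integral>\<^sup>+\<omega>. ennreal ((norm (\<nu> - orth_proj (S (mhat \<omega>)) (\<nu> + E \<omega>)))\<^sup>2) \<partial>P)
    \<le> ereal (K / (K - 1) * ((norm (\<nu> - orth_proj (S m) \<nu>))\<^sup>2 * (1 + pen m / real (codim (S m)))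
               + pen m - real (dim (S m)) + c + K * r))"
proof -
  interpret prob_space P by fact
  define \<tau> where "\<tau> m = real (dim (S m) + 1) * Dkhi (dim (S m) + 1) (codim (S m) - 1)
            (real (codim (S m) - 1) / (K * real (codim (S m))) * (pen m + c))" for m
  have \<tau>: "0 \<le> \<tau> m" for m by (simp add: \<tau>_def Dkhi_nonneg)
  have "\<forall>m\<in>\<M>. \<exists>W. subspace W \<and> S m \<subseteq> W \<and> \<nu> \<in> W \<and> dim W = dim (S m) + 1 \<and> codim W = codim (S m) - 1"
    using subspace_enlarge[OF S, where a = \<nu>] cod by (metis Suc_1 Suc_leD One_nat_def)
  then obtain W where W: "\<And>m. m \<in> \<M> \<Longrightarrow> subspace (W m)" "\<And>m. m \<in> \<M> \<Longrightarrow> S m \<subseteq> W m"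
      "\<And>m. m \<in> \<M> \<Longrightarrow> \<nu> \<in> W m" "\<And>m. m \<in> \<M> \<Longrightarrow> dim (W m) = dim (S m) + 1"
      "\<And>m. m \<in> \<M> \<Longrightarrow> codim (W m) = codim (S m) - 1"
    by metis
  define T where "T m \<omega> = excess K c (pen m) (codim (S m)) (W m) (E \<omega>)" for m \<omega>
  have Tint: "integrable P (T m)" and Tle: "(\<integral>\<omega>. T m \<omega> \<partial>P) \<le> K * \<tau> m" if "m \<in> \<M>" for m
  proof -
    have N: "codim (W m) + 1 = codim (S m)" and pos: "codim (W m) > 0" "dim (W m) > 0"
      using W[OF that] cod[OF that] by auto
    have K0: "K > 0" using K by simp
    note ex = std_gaussian_excess[OF W(1)[OF that] K0 pen[OF that] c pos(2,1),
        folded law, unfolded N, unfolded W(4,5)[OF that]]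
    have mb: "excess K c (pen m) (codim (S m)) (W m) \<in> borel_measurable borel"
      using borel_measurable_integrable[OF ex(1)] by simp
    show "integrable P (T m)"
      unfolding T_def using ex(1) by (subst (asm) integrable_distr_eq[OF E mb])
    show "(\<integral>\<omega>. T m \<omega> \<partial>P) \<le> K * \<tau> m"
      unfolding T_def \<tau>_def using ex(2) by (subst (asm) integral_distr[OF E mb])
  qed
  have T0: "0 \<le> T m \<omega>" for m \<omega> by (simp add: T_def excess_def)
  have Tm: "(\<lambda>\<omega>. ennreal (T m \<omega>)) \<in> borel_measurable P" if "m \<in> \<M>" for m
    using borel_measurable_integrable[OF Tint[OF that]] by (rule measurable_compose[OF _ measurable_ennreal])
  \<comment> \<open>The sum of the excesses is formed in the extended reals, where it always exists; being integrable,
    it is finite almost surely and can then be treated as a real random variable.\<close>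
  define V where "V \<omega> = (\<integral>\<^sup>+m. ennreal (T m \<omega>) \<partial>count_space \<M>)" for \<omega>
  have V[measurable]: "V \<in> borel_measurable P"
    unfolding V_def by (intro borel_measurable_nn_integral_countable[OF cnt] Tm)
  have r0: "0 \<le> r"
  proof -
    have "0 \<le> (\<Sum>\<^sub>\<infinity>m\<in>\<M>. ereal (\<tau> m))" using \<tau> by (intro infsum_nonneg) simp
    then show ?thesis using r by (simp add: \<tau>_def)
  qed
  have V_le: "(\<integral>\<^sup>+\<omega>. V \<omega> \<partial>P) \<le> ennreal (K * r)"
  proof -
    have "(\<integral>\<^sup>+\<omega>. V \<omega> \<partial>P) = (\<integral>\<^sup>+m. \<integral>\<^sup>+\<omega>. ennreal (T m \<omega>) \<partial>P \<partial>count_space \<M>)"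
      unfolding V_def by (intro nn_integral_count_space_nn_integral[OF cnt] Tm)
    also have "\<dots> \<le> (\<integral>\<^sup>+m. ennreal K * ennreal (\<tau> m) \<partial>count_space \<M>)"
    proof (rule nn_integral_mono)
      fix m assume "m \<in> space (count_space \<M>)"
      then have "m \<in> \<M>" by simp
      then show "(\<integral>\<^sup>+\<omega>. ennreal (T m \<omega>) \<partial>P) \<le> ennreal K * ennreal (\<tau> m)"
        using Tint Tle T0 K \<tau> by (subst nn_integral_eq_integral) (auto simp: ennreal_mult[symmetric] intro!: ennreal_leI)
    qed
    also have "\<dots> = ennreal K * (\<integral>\<^sup>+m. ennreal (\<tau> m) \<partial>count_space \<M>)"
      by (rule nn_integral_cmult) simp
    also have "\<dots> \<le> ennreal K * ennreal r"
      using \<tau> r by (intro mult_left_mono nn_integral_count_space_le_infsum) (simp_all add: \<tau>_def)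
    finally show ?thesis using K r0 by (simp add: ennreal_mult)
  qed
  have V_fin: "AE \<omega> in P. V \<omega> \<noteq> \<infinity>"
    using V_le by (intro nn_integral_noteq_infinite) (auto simp: top_unique)
  have V_real: "(\<integral>\<^sup>+\<omega>. ennreal (enn2real (V \<omega>)) \<partial>P) \<le> ennreal (K * r)"
    using V_fin by (intro order_trans[OF nn_integral_mono_AE V_le]) (auto simp: less_top)
  have V_int: "integrable P (\<lambda>\<omega>. enn2real (V \<omega>))"
    using V_real by (intro integrableI_nonneg) (auto simp: less_top[symmetric] top_unique)
  have V_mean: "(\<integral>\<omega>. enn2real (V \<omega>) \<partial>P) \<le> K * r"
    using V_real K r0 by (subst (asm) nn_integral_eq_integral[OF V_int]) auto
  \<comment> \<open>The squared noise is subtracted because the loss is compared with the residual only up to it;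
    \<open>X\<close> may be negative, hence real-valued integrals from here on.\<close>
  define X where "X \<omega> = crit_L S pen (\<nu> + E \<omega>) m - (norm (E \<omega>))\<^sup>2" for \<omega>
  define a where "a = (norm (\<nu> - orth_proj (S m) \<nu>))\<^sup>2 * (1 + pen m / real (codim (S m))) + pen m - real (dim (S m))"
  have X: "has_bochner_integral P X a"
  proof -
    note [measurable] = borel_measurable_linear[OF linear_orth_proj[OF S[OF m]]]
    have "has_bochner_integral (distr P borel E)
       (\<lambda>x. (norm (\<nu> + x - orth_proj (S m) (\<nu> + x)))\<^sup>2 * (1 + pen m / real (codim (S m))) - (norm x)\<^sup>2)
       (((norm (\<nu> - orth_proj (S m) \<nu>))\<^sup>2 + real (codim (S m))) * (1 + pen m / real (codim (S m))) - real CARD('n))"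
      unfolding law
      by (intro has_bochner_integral_diff has_bochner_integral_mult_left std_gaussian_residual_mean
          std_gaussian_norm_square S m)
    moreover have "((norm (\<nu> - orth_proj (S m) \<nu>))\<^sup>2 + real (codim (S m))) * (1 + pen m / real (codim (S m))) - real CARD('n) = a"
    proof -
      have "dim (S m) \<le> CARD('n)" using dim_subset_UNIV[of "S m"] by simp
      then have "real (codim (S m)) = real CARD('n) - real (dim (S m))" by (simp add: codim_def)
      moreover have "real (codim (S m)) * (1 + pen m / real (codim (S m))) = real (codim (S m)) + pen m"
        using cod[OF m] by (simp add: field_simps)
      ultimately show ?thesis by (simp only: a_def distrib_right)
    qed
    ultimately show ?thesis
      unfolding X_def crit_L_def by (subst (asm) has_bochner_integral_distr_iff) simp_all
  qed
  let ?B = "\<lambda>\<omega>. K / (K - 1) * (X \<omega> + c + enn2real (V \<omega>))"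
  have bound: "AE \<omega> in P. (norm (\<nu> - orth_proj (S (mhat \<omega>)) (\<nu> + E \<omega>)))\<^sup>2 \<le> ?B \<omega>"
    using mhat V_fin
  proof eventually_elim
    case (elim \<omega>)
    let ?k = "mhat \<omega>"
    have k: "?k \<in> \<M>" and le: "crit_L S pen (\<nu> + E \<omega>) ?k \<le> crit_L S pen (\<nu> + E \<omega>) m"
      using elim m by auto
    have "(1 - 1 / K) * (norm (\<nu> - orth_proj (S ?k) (\<nu> + E \<omega>)))\<^sup>2 \<le> X \<omega> + c + T ?k \<omega>"
      using normalized_loss_le[OF S[OF k] W(1-3)[OF k] _ pen[OF k] le, of K c] K
      by (simp add: X_def T_def)
    moreover have "ennreal (T ?k \<omega>) \<le> V \<omega>"
      unfolding V_def using k by (rule nn_integral_ge_point)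
    then have "T ?k \<omega> \<le> enn2real (V \<omega>)"
      using elim T0 by (cases "V \<omega>") auto
    ultimately have "(1 - 1 / K) * (norm (\<nu> - orth_proj (S ?k) (\<nu> + E \<omega>)))\<^sup>2 \<le> X \<omega> + c + enn2real (V \<omega>)"
      by simp
    then have "K / (K - 1) * ((1 - 1 / K) * (norm (\<nu> - orth_proj (S ?k) (\<nu> + E \<omega>)))\<^sup>2) \<le> ?B \<omega>"
      using K by (intro mult_left_mono) auto
    moreover have "K / (K - 1) * (1 - 1 / K) = 1" using K by (simp add: field_simps)
    ultimately show ?case by (simp only: mult.assoc[symmetric] mult_1)
  qed
  \<comment> \<open>Some summands of the bound may be negative, but the bound itself is not, since it dominates a square;
    otherwise \<^const>\<open>ennreal\<close> would truncate it.\<close>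
  have B_nonneg: "AE \<omega> in P. 0 \<le> ?B \<omega>"
    using bound by eventually_elim (rule order_trans[OF zero_le_power2])
  have B_int: "has_bochner_integral P ?B (K / (K - 1) * (a + c + (\<integral>\<omega>. enn2real (V \<omega>) \<partial>P)))"
    using X V_int by (simp add: has_bochner_integral_iff prob_space)
  have "(\<integral>\<^sup>+\<omega>. ennreal ((norm (\<nu> - orth_proj (S (mhat \<omega>)) (\<nu> + E \<omega>)))\<^sup>2) \<partial>P) \<le> (\<integral>\<^sup>+\<omega>. ennreal (?B \<omega>) \<partial>P)"
    using bound by (intro nn_integral_mono_AE) (auto intro: ennreal_leI)
  also have "\<dots> = ennreal (\<integral>\<omega>. ?B \<omega> \<partial>P)"
    using B_int B_nonneg unfolding has_bochner_integral_iff by (intro nn_integral_eq_integral) simp_all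
  finally have "enn2ereal (\<integral>\<^sup>+\<omega>. ennreal ((norm (\<nu> - orth_proj (S (mhat \<omega>)) (\<nu> + E \<omega>)))\<^sup>2) \<partial>P)
      \<le> ereal (\<integral>\<omega>. ?B \<omega> \<partial>P)"
    using integral_nonneg_AE[OF B_nonneg] by (simp add: less_eq_ennreal.rep_eq enn2ereal_ennreal)
  also have "(\<integral>\<omega>. ?B \<omega> \<partial>P) = K / (K - 1) * (a + c + (\<integral>\<omega>. enn2real (V \<omega>) \<partial>P))"
    using B_int by (rule has_bochner_integral_integral_eq)
  also have "\<dots> \<le> K / (K - 1) * (a + c + K * r)"
    using V_mean K by (intro mult_left_mono) auto
  finally show ?thesis by (simp add: a_def)
qed

theorem theorem2:
  fixes P :: "'w measure"
    and \<epsilon> :: "'n::finite \<Rightarrow> 'w \<Rightarrow> real"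
    and \<mu> :: "real ^ 'n" and \<sigma> :: real
    and \<M> :: "'m set" and S :: "'m \<Rightarrow> (real ^ 'n) set"
    and pen :: "'m \<Rightarrow> real" and mhat :: "'w \<Rightarrow> 'm"
    and K c :: real
  assumes "prob_space P"
    and "prob_space.indep_vars P (\<lambda>_. borel) \<epsilon> UNIV"
    and "\<And>i. distributed P lborel (\<epsilon> i) std_normal_density"
    and "\<sigma> > 0"
    and "countable \<M>"
    and "\<And>m. m \<in> \<M> \<Longrightarrow> subspace (S m)"
    and "\<And>m. m \<in> \<M> \<Longrightarrow> codim (S m) \<ge> 2"
    and "\<And>m. m \<in> \<M> \<Longrightarrow> pen m \<ge> 0"
    and "AE \<omega> in P. mhat \<omega> \<in> \<M> \<and>
           (\<forall>m\<in>\<M>. crit_L S pen (observation \<mu> \<sigma> \<epsilon> \<omega>) (mhat \<omega>)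
                     \<le> crit_L S pen (observation \<mu> \<sigma> \<epsilon> \<omega>) m)"
    and "c \<ge> 0" and "K > 1"
  shows "enn2ereal (\<integral>\<^sup>+\<omega>. ennreal
             ((norm (\<mu> - orth_proj (S (mhat \<omega>)) (observation \<mu> \<sigma> \<epsilon> \<omega>)))\<^sup>2 / \<sigma>\<^sup>2) \<partial>P)
       \<le> ereal (K / (K - 1)) *
           (INF m\<in>\<M>. ereal
              ((norm (\<mu> - orth_proj (S m) \<mu>))\<^sup>2 / \<sigma>\<^sup>2 * (1 + pen m / real (codim (S m)))
               + pen m - real (dim (S m))))
         + risk_remainder \<M> S pen K c"
proof -
  \<comment> \<open>Dividing the model by \<open>\<sigma>\<close> reduces everything to unit noise level.\<close>
  define \<nu> where "\<nu> = \<mu> /\<^sub>R \<sigma>"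
  define E where "E \<omega> = (\<chi> i. \<epsilon> i \<omega>)" for \<omega>
  note S = assms(6)
  note noise = distr_noise_std_gaussian[OF assms(1-3), folded E_def]
  have \<mu>: "\<mu> = \<sigma> *\<^sub>R \<nu>" using \<open>\<sigma> > 0\<close> by (simp add: \<nu>_def)
  have obs: "observation \<mu> \<sigma> \<epsilon> \<omega> = \<sigma> *\<^sub>R (\<nu> + E \<omega>)" for \<omega>
    by (simp add: observation_def E_def \<mu> vec_eq_iff distrib_left)
  have proj: "orth_proj (S m) (\<sigma> *\<^sub>R y) = \<sigma> *\<^sub>R orth_proj (S m) y" if "m \<in> \<M>" for m y
    using linear_orth_proj[OF S[OF that]] by (rule linear_cmul)
  have scale: "(norm (\<sigma> *\<^sub>R x - \<sigma> *\<^sub>R y))\<^sup>2 = \<sigma>\<^sup>2 * (norm (x - y))\<^sup>2" for x y :: "real ^ 'n"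
    by (simp add: scaleR_diff_right[symmetric] power_mult_distrib)
  have crit: "crit_L S pen (\<sigma> *\<^sub>R y) m = \<sigma>\<^sup>2 * crit_L S pen y m" if "m \<in> \<M>" for m y
    by (simp add: crit_L_def proj[OF that] scale)
  have mhat: "AE \<omega> in P. mhat \<omega> \<in> \<M> \<and>
      (\<forall>m\<in>\<M>. crit_L S pen (\<nu> + E \<omega>) (mhat \<omega>) \<le> crit_L S pen (\<nu> + E \<omega>) m)"
    using assms(9) by eventually_elim (use \<open>\<sigma> > 0\<close> in \<open>auto simp: obs crit\<close>)
  interpret prob_space P by fact
  have "\<M> \<noteq> {}"
  proof
    assume "\<M> = {}"
    then have "AE \<omega> in P. False" using mhat by simp
    then show False by simp
  qed
  have loss: "(\<integral>\<^sup>+\<omega>. ennreal ((norm (\<mu> - orth_proj (S (mhat \<omega>)) (observation \<mu> \<sigma> \<epsilon> \<omega>)))\<^sup>2 / \<sigma>\<^sup>2) \<partial>P)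
      = (\<integral>\<^sup>+\<omega>. ennreal ((norm (\<nu> - orth_proj (S (mhat \<omega>)) (\<nu> + E \<omega>)))\<^sup>2) \<partial>P)"
  proof (rule nn_integral_cong_AE)
    show "AE \<omega> in P. ennreal ((norm (\<mu> - orth_proj (S (mhat \<omega>)) (observation \<mu> \<sigma> \<epsilon> \<omega>)))\<^sup>2 / \<sigma>\<^sup>2)
        = ennreal ((norm (\<nu> - orth_proj (S (mhat \<omega>)) (\<nu> + E \<omega>)))\<^sup>2)"
      using mhat
    proof eventually_elim
      case (elim \<omega>)
      then have "mhat \<omega> \<in> \<M>" by simp
      then show ?case using \<open>\<sigma> > 0\<close> by (simp only: obs proj) (simp add: \<mu> scale)
    qed
  qed
  have bias: "(norm (\<mu> - orth_proj (S m) \<mu>))\<^sup>2 / \<sigma>\<^sup>2 = (norm (\<nu> - orth_proj (S m) \<nu>))\<^sup>2" if "m \<in> \<M>" for m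
    using \<open>\<sigma> > 0\<close> by (simp add: \<mu> proj[OF that] scale)
  define \<Sigma> where "\<Sigma> = (\<Sum>\<^sub>\<infinity>m\<in>\<M>. ereal (real (dim (S m) + 1) *
          Dkhi (dim (S m) + 1) (codim (S m) - 1)
            (real (codim (S m) - 1) / (K * real (codim (S m))) * (pen m + c))))"
  have "0 \<le> \<Sigma>"
    unfolding \<Sigma>_def by (intro infsum_nonneg) (simp add: Dkhi_nonneg)
  define R where "R m = (norm (\<mu> - orth_proj (S m) \<mu>))\<^sup>2 / \<sigma>\<^sup>2 * (1 + pen m / real (codim (S m)))
               + pen m - real (dim (S m))" for m
  let ?L = "\<integral>\<^sup>+\<omega>. ennreal ((norm (\<mu> - orth_proj (S (mhat \<omega>)) (observation \<mu> \<sigma> \<epsilon> \<omega>)))\<^sup>2 / \<sigma>\<^sup>2) \<partial>P"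
  have "enn2ereal ?L \<le> ereal (K / (K - 1)) * (INF m\<in>\<M>. ereal (R m))
      + (ereal (K * c / (K - 1)) + ereal (2 * K\<^sup>2 / (K - 1)) * \<Sigma>)"
  proof (cases \<Sigma>)
    case PInf
    then show ?thesis using \<open>K > 1\<close> by simp
  next
    case MInf
    then show ?thesis using \<open>0 \<le> \<Sigma>\<close> by simp
  next
    case (real r)
    then have "0 \<le> r" using \<open>0 \<le> \<Sigma>\<close> by simp
    \<comment> \<open>The bound for a fixed model has the factor \<open>K\<^sup>2 / (K - 1)\<close> on \<open>r\<close>, half of what is claimed.\<close>
    let ?s = "K * c / (K - 1) + 2 * K\<^sup>2 / (K - 1) * r"
    have "enn2ereal ?L \<le> ereal (K / (K - 1) * R m + ?s)" if m: "m \<in> \<M>" for m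
    proof -
      have "enn2ereal ?L \<le> ereal (K / (K - 1) * (R m + c + K * r))"
        using normalized_oracle_inequality[OF assms(1) noise assms(5-8) mhat assms(10,11)
            real[unfolded \<Sigma>_def] m] loss
        by (simp add: R_def bias[OF m])
      also have "K / (K - 1) * (R m + c + K * r) \<le> K / (K - 1) * R m + ?s"
      proof -
        have "0 \<le> K\<^sup>2 / (K - 1) * r" using \<open>0 \<le> r\<close> \<open>K > 1\<close> by simp
        moreover have "K / (K - 1) * (R m + c + K * r) = K / (K - 1) * R m + K * c / (K - 1) + K\<^sup>2 / (K - 1) * r"
          by (simp add: distrib_left power2_eq_square)
        ultimately show ?thesis by simp
      qed
      finally show ?thesis by simp
    qed
    then have "enn2ereal ?L \<le> ereal (K / (K - 1)) * (INF m\<in>\<M>. ereal (R m)) + ereal ?s"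
      using \<open>\<M> \<noteq> {}\<close> \<open>K > 1\<close> by (intro ereal_le_mult_INF_add) auto
    then show ?thesis by (simp add: real)
  qed
  then show ?thesis by (simp only: risk_remainder_def R_def \<Sigma>_def)
qed

end
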